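(* Let $\{E_1,E_2,\ldots,E_k\}$ be a complete orthogonal symmetric idempotent (COSI) set of complex $n\times n$ matrices. Let $$G=\begin{pmatrix} E_{11}\alpha_{11} & E_{12}\alpha_{12} & \cdots & E_{1k}\alpha_{1k}\\ E_{21}\alpha_{21} & E_{22}\alpha_{22} & \cdots & E_{2k}\alpha_{2k}\\ \vdots & \vdots & & \vdots\\ E_{k1}\alpha_{k1} & E_{k2}\alpha_{k2} & \cdots & E_{kk}\alpha_{kk}\end{pmatrix},$$ where every $E_{ij}$ belongs to $\{E_1,\ldots,E_k\}$ and each $E_j$ ($1\le j\le k$) appears exactly once in each block row and exactly once in each block column of the array $(E_{ij})$. (i) If the $\alpha_{ij}$ are (commuting) variables, then $GG^*=I$, so that $G$ is a paraunitary matrix. (ii) If the $\alpha_{ij}$ are complex numbers with $|\alpha_{ij}|=1$ for all $i,j$, then $G$ is a unitary matrix.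
   Context: For a complex matrix $A$, $A^*$ denotes the complex conjugate transpose. A square matrix $A$ is unitary if $AA^*=I$. A matrix $E$ is idempotent if $E^2=E$, and symmetric if $E^*=E$. A complete orthogonal symmetric idempotent (COSI) set of $n\times n$ matrices is a set $\{E_1,\ldots,E_k\}$ of $n\times n$ symmetric idempotents such that $E_iE_j=0$ for $i\neq j$ and $E_1+\cdots+E_k=I_n$. For a variable $\alpha$ one sets $\alpha^*=\alpha^{-1}$; accordingly, for a matrix $G$ with entries in the Laurent polynomial ring over $\mathbb{C}$ in commuting variables, $G^*$ is the matrix obtained by transposing, conjugating the complex coefficients, and replacing each variable by its inverse. A paraunitary matrix over $\mathbb{C}$ is a square matrix $U(\mathbf{z})$ in a vector of commuting variables $\mathbf{z}=(z_1,\ldots,z_m)$ with $U(\mathbf{z})U^*(\mathbf{z}^{-1})=I$, where $\mathbf{z}^{-1}=(z_1^{-1},\ldots,z_m^{-1})$ and in $U^*(\mathbf{z}^{-1})$ the matrix is transposed, the coefficients are conjugated and each $z_i$ is replaced by $z_i^{-1}$ (that is, $UU^*=I$ with the convention $z_i^*=z_i^{-1}$). *)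

theory Defs
  imports "HOL-Analysis.Analysis" "HOL-Library.Poly_Mapping"
begin

definition conj_transpose :: "complex^'n^'m \<Rightarrow> complex^'m^'n" where
  "conj_transpose A = map_matrix cnj (transpose A)"

definition unitary :: "complex^'n^'n \<Rightarrow> bool" where
  "unitary A \<longleftrightarrow> A ** conj_transpose A = mat 1"

definition idempotent_matrix :: "complex^'n^'n \<Rightarrow> bool" where
  "idempotent_matrix E \<longleftrightarrow> E ** E = E"

text \<open>Symmetric is meant with respect to the conjugate transpose, i.e. Hermitian.\<close>

definition symmetric_matrix :: "complex^'n^'n \<Rightarrow> bool" where
  "symmetric_matrix E \<longleftrightarrow> conj_transpose E = E"

definition COSI :: "(complex^'n^'n) set \<Rightarrow> bool" where
  "COSI S \<longleftrightarrow> finite S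
     \<and> (\<forall>E\<in>S. idempotent_matrix E \<and> symmetric_matrix E)
     \<and> (\<forall>E\<in>S. \<forall>F\<in>S. E \<noteq> F \<longrightarrow> E ** F = 0)
     \<and> (\<Sum>E\<in>S. E) = mat 1"

text \<open>
  The Laurent polynomial ring over the complex numbers in commuting variables indexed by \<open>'v\<close>
  is the group algebra of the free abelian group on \<open>'v\<close>: an exponent vector is a finitely
  supported map from \<open>'v\<close> to the integers, and a Laurent polynomial maps finitely many exponent
  vectors to nonzero coefficients. The ring structure is the convolution product of
  \<^theory>\<open>HOL-Library.Poly_Mapping\<close>.
\<close>

type_synonym 'v laurent = "('v \<Rightarrow>\<^sub>0 int) \<Rightarrow>\<^sub>0 complex"

definition laurent_const :: "complex \<Rightarrow> 'v laurent" where
  "laurent_const c = Poly_Mapping.single 0 c"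

definition laurent_var :: "'v \<Rightarrow> 'v laurent" where
  "laurent_var v = Poly_Mapping.single (Poly_Mapping.single v 1) 1"

text \<open>Conjugate the coefficients and replace each variable by its inverse (negate all exponents).\<close>

definition laurent_star :: "'v laurent \<Rightarrow> 'v laurent" where
  "laurent_star p = Poly_Mapping.map_key uminus (Poly_Mapping.map cnj p)"

lemma lookup_laurent_star:
  "Poly_Mapping.lookup (laurent_star p) e = cnj (Poly_Mapping.lookup p (- e))"
proof -
  have "inj (uminus :: ('a \<Rightarrow>\<^sub>0 int) \<Rightarrow> _)"
    by (simp add: inj_on_def)
  then show ?thesis
    unfolding laurent_star_def
    by (simp add: Poly_Mapping.map_key.rep_eq Poly_Mapping.map.rep_eq when_def)
qed

lemma laurent_star_single:
  "laurent_star (Poly_Mapping.single e c) = Poly_Mapping.single (- e) (cnj c)"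
  by (rule poly_mapping_eqI) (auto simp: lookup_laurent_star lookup_single when_def)

lemma laurent_star_const: "laurent_star (laurent_const c) = laurent_const (cnj c)"
  by (simp add: laurent_const_def laurent_star_single)

lemma laurent_var_mult_star: "laurent_var v * laurent_star (laurent_var v) = 1"
  by (simp add: laurent_var_def laurent_star_single mult_single)

definition laurent_conj_transpose :: "('v laurent)^'n^'m \<Rightarrow> ('v laurent)^'m^'n" where
  "laurent_conj_transpose G = map_matrix laurent_star (transpose G)"

definition paraunitary :: "('v laurent)^'n^'n \<Rightarrow> bool" where
  "paraunitary U \<longleftrightarrow> U ** laurent_conj_transpose U = mat 1"

text \<open>
  The matrix obtained by multiplying every entry of \<open>A\<close> by \<open>a\<close>. The operation \<open>*\<^sub>R\<close> only
  provides real scalars.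
\<close>

definition scale_matrix :: "'a::times^'n^'m \<Rightarrow> 'a \<Rightarrow> 'a^'n^'m" where
  "scale_matrix A a = map_matrix (\<lambda>x. x * a) A"

text \<open>
  The index \<open>(i, r)\<close> denotes the \<open>r\<close>-th row (or column) inside the \<open>i\<close>-th block row (or column).
\<close>

definition block_matrix :: "('k::finite \<Rightarrow> 'k \<Rightarrow> 'a^'n^'n) \<Rightarrow> 'a^('k \<times> 'n)^('k \<times> 'n)" where
  "block_matrix M = (\<chi> p q. M (fst p) (fst q) $ snd p $ snd q)"

end

theory Submission
  imports Defs
begin

text \<open>
  The \<open>(i, j)\<close> block of \<open>G G\<^sup>*\<close> is the sum over \<open>l\<close> of
  \<open>B i l (B j l)\<^sup>*\<close> times the scalar \<open>\<alpha>\<^sub>i\<^sub>l \<alpha>\<^sub>j\<^sub>l\<^sup>*\<close>.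
  For \<open>i \<noteq> j\<close> the two idempotents stand in the same block column, hence are different, and
  every summand vanishes by orthogonality, whatever the scalars are. For \<open>i = j\<close> the scalars
  cancel and each summand collapses to \<open>B i l\<close>; since the block row \<open>i\<close> lists the COSI set
  once, completeness turns the sum into the identity.

  The only facts about the scalars that enter are that they lie in a commutative ring, that complex
  coefficients embed into it compatibly with the involutions, and that
  \<open>\<alpha> \<alpha>\<^sup>* = 1\<close>. Both parts of the theorem are therefore instances of one
  statement, \<open>block_matrix_mult_star\<close>: for variables the ring is that of Laurent polynomials,
  for numbers of modulus one it is the field of complex numbers itself. The properties of the
  array are isolated in \<open>COSI_row_sum\<close> and \<open>COSI_column_mult_conj_transpose\<close>.
\<close>

lemma COSI_row_sum:
  fixes E :: "'k::finite \<Rightarrow> complex^'n^'n"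
  assumes "COSI (range E)"
    and B: "\<And>j. B j \<in> range E"
    and once: "\<And>l. \<exists>!j::'k. B j = E l"
  shows "(\<Sum>j\<in>UNIV. B j) = mat 1"
proof -
  have "inj B"
  proof (rule injI)
    fix x y
    assume "B x = B y"
    moreover obtain l where "B x = E l"
      using B[of x] by auto
    ultimately show "x = y"
      using once[of l] by auto
  qed
  moreover have "range B = range E"
  proof
    show "range B \<subseteq> range E"
      using B by auto
    show "range E \<subseteq> range B"
      using once by (metis image_subsetI rangeI)
  qed
  ultimately have "(\<Sum>j\<in>UNIV. B j) = (\<Sum>F\<in>range E. F)"
    by (metis sum.reindex_cong)
  then show ?thesis
    using assms(1) by (simp add: COSI_def)
qed

lemma COSI_column_mult_conj_transpose:
  fixes E :: "'k \<Rightarrow> complex^'n^'n"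
  assumes "COSI (range E)"
    and B: "\<And>i. B i \<in> range E"
    and once: "\<And>l. \<exists>!i. B i = E l"
  shows "B i ** conj_transpose (B j) = (if i = j then B i else 0)"
proof -
  have hermitian: "conj_transpose F = F" and idempotent: "F ** F = F" if "F \<in> range E" for F
    using assms(1) that
    by (simp_all only: COSI_def symmetric_matrix_def idempotent_matrix_def)
  have orthogonal: "F ** F' = 0" if "F \<in> range E" "F' \<in> range E" "F \<noteq> F'" for F F'
    using assms(1) that unfolding COSI_def by metis
  have "conj_transpose (B j) = B j" and "B i ** B i = B i"
    by (rule hermitian[OF B], rule idempotent[OF B])
  moreover have "B i ** B j = 0" if "i \<noteq> j"
  proof -
    obtain l where "B i = E l"
      using B[of i] by auto
    then have "B i \<noteq> B j"
      using once[of l] that by metis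
    then show ?thesis
      by (rule orthogonal[OF B B])
  qed
  ultimately show ?thesis
    by auto
qed

text \<open>
  Here \<open>c\<close> embeds the complex coefficients into the ring of scalars and \<open>s\<close> is the
  involution of that ring. Every entry of the block matrix is a complex coefficient times one of the
  scalars \<open>u i j\<close>, so stating how \<open>s\<close> acts on such products determines the starred matrix.
\<close>

lemma block_matrix_mult_star:
  fixes E :: "'k::finite \<Rightarrow> complex^'n^'n"
    and B :: "'k \<Rightarrow> 'k \<Rightarrow> complex^'n^'n"
    and c :: "complex \<Rightarrow> 'a::comm_ring_1"
    and u :: "'k \<Rightarrow> 'k \<Rightarrow> 'a"
  assumes cosi: "COSI (range E)"
    and B: "\<And>i j. B i j \<in> range E"
    and row: "\<And>i l. \<exists>!j. B i j = E l"
    and column: "\<And>j l. \<exists>!i. B i j = E l"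
    and c_add: "\<And>x y. c (x + y) = c x + c y"
    and c_mult: "\<And>x y. c (x * y) = c x * c y"
    and c_1: "c 1 = 1"
    and s_mult: "\<And>i j z. s (c z * u i j) = c (cnj z) * s (u i j)"
    and s_unit: "\<And>i j. u i j * s (u i j) = 1"
  defines "G \<equiv> block_matrix (\<lambda>i j. scale_matrix (map_matrix c (B i j)) (u i j))"
  shows "G ** map_matrix s (transpose G) = mat 1"
proof -
  have c_0: "c 0 = 0"
    using c_add[of 0 0] by simp
  have c_sum: "c (sum f A) = (\<Sum>x\<in>A. c (f x))" for f and A :: "'b set"
    by (induction A rule: infinite_finite_induct) (simp_all add: c_0 c_add)
  have "(G ** map_matrix s (transpose G)) $ (i, r) $ (j, t) = mat 1 $ (i, r) $ (j, t)"
    for i j r t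
  proof -
    have "(G ** map_matrix s (transpose G)) $ (i, r) $ (j, t)
        = (\<Sum>l\<in>UNIV. \<Sum>x\<in>UNIV.
            c (B i l $ r $ x) * u i l * (c (cnj (B j l $ t $ x)) * s (u j l)))"
      by (simp add: G_def matrix_matrix_mult_def map_matrix_def transpose_def block_matrix_def
          scale_matrix_def s_mult sum.cartesian_product case_prod_unfold)
    also have "\<dots> = (\<Sum>l\<in>UNIV. c ((B i l ** conj_transpose (B j l)) $ r $ t)
        * (u i l * s (u j l)))"
      by (simp add: matrix_matrix_mult_def conj_transpose_def map_matrix_def transpose_def
          c_sum c_mult sum_distrib_left mult_ac)
    also have "\<dots> = (\<Sum>l\<in>UNIV. if i = j then c (B i l $ r $ t) else 0)"
      by (rule sum.cong)
        (simp_all add: COSI_column_mult_conj_transpose[OF cosi B column] s_unit c_0)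
    also have "\<dots> = (if i = j then c ((\<Sum>l\<in>UNIV. B i l) $ r $ t) else 0)"
      by (simp add: c_sum)
    also have "\<dots> = mat 1 $ (i, r) $ (j, t)"
      by (simp add: COSI_row_sum[OF cosi B row] mat_def c_0 c_1)
    finally show ?thesis .
  qed
  then show ?thesis
    by (simp add: vec_eq_iff split_paired_all)
qed

theorem proposition2p2:
  fixes E :: "'k::finite \<Rightarrow> complex^'n^'n"
    and B :: "'k \<Rightarrow> 'k \<Rightarrow> complex^'n^'n"
    and v :: "'k \<Rightarrow> 'k \<Rightarrow> 'v"
    and \<alpha> :: "'k \<Rightarrow> 'k \<Rightarrow> complex"
  assumes "inj E"
    and "COSI (range E)"
    and "\<And>i j. B i j \<in> range E"
    and "\<And>i l. \<exists>!j. B i j = E l"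
    and "\<And>j l. \<exists>!i. B i j = E l"
  shows "(let G = block_matrix (\<lambda>i j. scale_matrix (map_matrix laurent_const (B i j))
                                        (laurent_var (v i j)))
          in G ** laurent_conj_transpose G = mat 1 \<and> paraunitary G)
       \<and> ((\<forall>i j. cmod (\<alpha> i j) = 1) \<longrightarrow>
          unitary (block_matrix (\<lambda>i j. scale_matrix (B i j) (\<alpha> i j))))"
proof -
  let ?G = "block_matrix (\<lambda>i j. scale_matrix (map_matrix laurent_const (B i j))
    (laurent_var (v i j)))"
  have "?G ** map_matrix laurent_star (transpose ?G) = mat 1"
  proof (rule block_matrix_mult_star[OF assms(2-5)])
    show "laurent_var (v i j) * laurent_star (laurent_var (v i j)) = 1" for i j
      by (rule laurent_var_mult_star)
  qed (simp_all add: laurent_const_def laurent_var_def laurent_star_single mult_single single_add)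
  moreover have "unitary (block_matrix (\<lambda>i j. scale_matrix (B i j) (\<alpha> i j)))"
    if "\<forall>i j. cmod (\<alpha> i j) = 1"
  proof -
    let ?H = "block_matrix (\<lambda>i j. scale_matrix (map_matrix (\<lambda>x. x) (B i j)) (\<alpha> i j))"
    have "?H ** map_matrix cnj (transpose ?H) = mat 1"
      by (rule block_matrix_mult_star[OF assms(2-5)])
        (simp_all add: complex_norm_square[symmetric] that)
    then show ?thesis
      by (simp add: unitary_def conj_transpose_def map_matrix_def)
  qed
  ultimately show ?thesis
    by (simp add: Let_def paraunitary_def laurent_conj_transpose_def)
qed

end
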